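(* Let $g$ and $m$ be two Riemannian metrics on a smooth manifold $M$, and let $\delta$ be the Euclidean metric induced by a local coordinate chart of $M$. Then, on the domain of the chart, $$R^{l}_{ijk}(\delta,m)= R^{l}_{ijk}(\delta,g) + R^{l}_{ijk}(g,m).$$
   Context: Indices refer to components in the local coordinate chart, and repeated indices are summed. The Euclidean metric $\delta$ induced by a coordinate chart is the metric, defined on the domain of the chart, whose component matrix in that chart is the identity, $\delta_{ab}$, at every point; covariant derivatives with respect to $\delta$ are the ordinary partial derivatives in that chart. For two metrics $g,m$ define $$\Gamma^{a}_{bc}(g,m) = \tfrac{1}{2}\, m^{an}\left(m_{nb;c}+m_{nc;b}-m_{bc;n}\right),$$ where $m^{an}$ is the inverse of $m_{an}$ and the semicolons denote covariant derivatives with respect to the Levi-Civita connection of $g$ (the first parameter). Writing $\Gamma$ for $\Gamma(g,m)$, define $$R^{l}_{ijk}(g,m)=\Gamma^{l}_{ik;j} - \Gamma^{l}_{ij;k}+ \Gamma^{l}_{js}\Gamma^{s}_{ik} - \Gamma^{l}_{ks}\Gamma^{s}_{ij},$$ where the semicolons again denote covariant derivatives with respect to the Levi-Civita connection of $g$, with $\Gamma^a_{bc}(g,m)$ regarded as a tensor field of type $(1,2)$. The same definitions apply to any ordered pair of metrics. In particular, $\Gamma^a_{bc}(\delta,g)$ are the usual Christoffel symbols of $g$ in the chart, and $R^{l}_{ijk}(\delta,g)$ and $R^{l}_{ijk}(\delta,m)$ are the components of the Riemann curvature tensors of $g$ and $m$ respectively, with the sign and index convention $V_{i;jk}-V_{i;kj}=V_l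 R^l_{ijk}$ for covector fields $V_i$. *)

theory Defs
  imports "HOL-Analysis.Analysis"
begin

section \<open>Smooth functions\<close>

primrec Ck_on :: "nat \<Rightarrow> 'e::real_normed_vector set \<Rightarrow> ('e \<Rightarrow> 'f::real_normed_vector) \<Rightarrow> bool" where
  "Ck_on 0 S f \<longleftrightarrow> continuous_on S f"
| "Ck_on (Suc k) S f \<longleftrightarrow>
     (\<forall>x\<in>S. f differentiable (at x)) \<and> (\<forall>v. Ck_on k S (\<lambda>x. frechet_derivative f (at x) v))"

text \<open>Only used for open subsets \<open>S\<close> of Euclidean spaces, where it is the usual
  \<open>C\<close>-infinity condition.\<close>

definition smooth_on :: "'e::real_normed_vector set \<Rightarrow> ('e \<Rightarrow> 'f::real_normed_vector) \<Rightarrow> bool" where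
  "smooth_on S f \<longleftrightarrow> (\<forall>k. Ck_on k S f)"


section \<open>Smooth manifolds\<close>

text \<open>A chart is a pair of its domain and its coordinate map; the values of the coordinate map
  outside of the domain are irrelevant.\<close>

type_synonym ('a, 'n) chart = "'a set \<times> ('a \<Rightarrow> real ^ 'n)"

abbreviation dom_chart :: "('a, 'n::finite) chart \<Rightarrow> 'a set" where "dom_chart \<equiv> fst"
abbreviation coord_map :: "('a, 'n::finite) chart \<Rightarrow> 'a \<Rightarrow> real ^ 'n" where "coord_map \<equiv> snd"

definition chart_inv :: "('a, 'n::finite) chart \<Rightarrow> real ^ 'n \<Rightarrow> 'a" where
  "chart_inv c = inv_into (dom_chart c) (coord_map c)"

definition topological_chart :: "'a topology \<Rightarrow> ('a, 'n::finite) chart \<Rightarrow> bool" where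
  "topological_chart X c \<longleftrightarrow>
     openin X (dom_chart c) \<and> open (coord_map c ` dom_chart c) \<and>
     homeomorphic_map (subtopology X (dom_chart c)) (top_of_set (coord_map c ` dom_chart c))
       (coord_map c)"

definition smooth_transition :: "('a, 'n::finite) chart \<Rightarrow> ('a, 'n) chart \<Rightarrow> bool" where
  "smooth_transition c d \<longleftrightarrow>
     smooth_on (coord_map c ` (dom_chart c \<inter> dom_chart d)) (coord_map d \<circ> chart_inv c)"

definition smooth_compatible :: "('a, 'n::finite) chart \<Rightarrow> ('a, 'n) chart \<Rightarrow> bool" where
  "smooth_compatible c d \<longleftrightarrow> smooth_transition c d \<and> smooth_transition d c"

record ('a, 'n) manifold =
  mtop :: "'a topology"
  atlas :: "('a, 'n) chart set"

definition smooth_manifold :: "('a, 'n::finite) manifold \<Rightarrow> bool" where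
  "smooth_manifold M \<longleftrightarrow>
     Hausdorff_space (mtop M) \<and> second_countable (mtop M) \<and>
     (\<forall>c\<in>atlas M. topological_chart (mtop M) c) \<and>
     (\<Union>c\<in>atlas M. dom_chart c) = topspace (mtop M) \<and>
     (\<forall>c\<in>atlas M. \<forall>d\<in>atlas M. smooth_compatible c d)"

text \<open>The charts of the manifold are those of the maximal atlas determined by \<^term>\<open>atlas M\<close>.\<close>

definition charts :: "('a, 'n::finite) manifold \<Rightarrow> ('a, 'n) chart set" where
  "charts M = {c. topological_chart (mtop M) c \<and> (\<forall>d\<in>atlas M. smooth_compatible c d)}"

definition smooth_near :: "('a, 'n::finite) manifold \<Rightarrow> 'a \<Rightarrow> ('a \<Rightarrow> real) \<Rightarrow> bool" where
  "smooth_near M p f \<longleftrightarrow>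
     (\<exists>W. openin (mtop M) W \<and> p \<in> W \<and>
        (\<forall>d\<in>atlas M. smooth_on (coord_map d ` (dom_chart d \<inter> W)) (f \<circ> chart_inv d)))"


section \<open>Tangent vectors\<close>

text \<open>Tangent vectors at \<open>p\<close> are the derivations at \<open>p\<close> of the algebra of germs of smooth functions.
  A germ is represented by any function that is smooth near \<open>p\<close>; on the other functions the
  derivation is set to zero, so that equal derivations are equal as HOL functions.\<close>

definition tangent_space :: "('a, 'n::finite) manifold \<Rightarrow> 'a \<Rightarrow> (('a \<Rightarrow> real) \<Rightarrow> real) set" where
  "tangent_space M p = {v.
     (\<forall>f h. smooth_near M p f \<longrightarrow> smooth_near M p h \<longrightarrow>
        v (\<lambda>q. f q + h q) = v f + v h \<and>
        v (\<lambda>q. f q * h q) = v f * h p + f p * v h \<and>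
        ((\<exists>W. openin (mtop M) W \<and> p \<in> W \<and> (\<forall>q\<in>W. f q = h q)) \<longrightarrow> v f = v h)) \<and>
     (\<forall>r f. smooth_near M p f \<longrightarrow> v (\<lambda>q. r * f q) = r * v f) \<and>
     (\<forall>f. \<not> smooth_near M p f \<longrightarrow> v f = 0)}"

text \<open>\<open>partial c i f p\<close> is the partial derivative, at the point \<open>p\<close>, of the function \<open>f\<close> on the
  manifold with respect to the \<open>i\<close>-th coordinate of the chart \<open>c\<close>.\<close>

definition partial :: "('a, 'n::finite) chart \<Rightarrow> 'n \<Rightarrow> ('a \<Rightarrow> real) \<Rightarrow> 'a \<Rightarrow> real" where
  "partial c i f p = frechet_derivative (f \<circ> chart_inv c) (at (coord_map c p)) (axis i 1)"

definition coord_vector ::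
    "('a, 'n::finite) manifold \<Rightarrow> ('a, 'n) chart \<Rightarrow> 'n \<Rightarrow> 'a \<Rightarrow> (('a \<Rightarrow> real) \<Rightarrow> real)" where
  "coord_vector M c i p = (\<lambda>f. if smooth_near M p f then partial c i f p else 0)"


section \<open>Riemannian metrics\<close>

type_synonym 'a metric_field = "'a \<Rightarrow> (('a \<Rightarrow> real) \<Rightarrow> real) \<Rightarrow> (('a \<Rightarrow> real) \<Rightarrow> real) \<Rightarrow> real"

text \<open>The component matrix at the point \<open>p\<close> of a metric in the chart \<open>c\<close>.\<close>

definition metric_comp ::
    "('a, 'n::finite) manifold \<Rightarrow> ('a, 'n) chart \<Rightarrow> 'a metric_field \<Rightarrow> 'a \<Rightarrow> real ^ 'n ^ 'n" where
  "metric_comp M c g p = (\<chi> a b. g p (coord_vector M c a p) (coord_vector M c b p))"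

definition riemannian_metric :: "('a, 'n::finite) manifold \<Rightarrow> 'a metric_field \<Rightarrow> bool" where
  "riemannian_metric M g \<longleftrightarrow>
     (\<forall>p\<in>topspace (mtop M).
        (\<forall>v\<in>tangent_space M p. \<forall>w\<in>tangent_space M p. g p v w = g p w v) \<and>
        (\<forall>u\<in>tangent_space M p. \<forall>v\<in>tangent_space M p. \<forall>w\<in>tangent_space M p. \<forall>r s.
           g p (\<lambda>f. r * u f + s * v f) w = r * g p u w + s * g p v w) \<and>
        (\<forall>v\<in>tangent_space M p. v \<noteq> (\<lambda>f. 0) \<longrightarrow> g p v v > 0)) \<and>
     (\<forall>c\<in>charts M. \<forall>a b.
        smooth_on (coord_map c ` dom_chart c) ((\<lambda>p. metric_comp M c g p $ a $ b) \<circ> chart_inv c))"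

text \<open>The Euclidean metric induced by a chart, as a metric on the domain of the chart: the tensor
  field \<open>\<delta>\<^sub>a\<^sub>b dx\<^sup>a dx\<^sup>b\<close>, using \<open>dx\<^sup>a(v) = v(x\<^sup>a)\<close>. By \<open>metric_comp_coord_euclidean_metric\<close> below,
  its component matrix in that chart is the identity.\<close>

definition coord_euclidean_metric :: "('a, 'n::finite) chart \<Rightarrow> 'a metric_field" where
  "coord_euclidean_metric c p v w =
     (\<Sum>a\<in>UNIV. \<Sum>b\<in>UNIV. (if a = b then 1 else 0) *
        v (\<lambda>q. coord_map c q $ a) * w (\<lambda>q. coord_map c q $ b))"


section \<open>Covariant derivatives, relative Christoffel symbols and relative curvature\<close>

text \<open>All components are taken in the chart \<open>c\<close>. In \<open>lc_coeff M c g a b d\<close> the index \<open>a\<close> is the upper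
  one.  That these are the coefficients of the Levi-Civita connection of \<open>g\<close>, that is, of the
  torsion-free connection for which \<open>g\<close> is parallel, is \<open>lc_coeff_unique\<close> below.\<close>

definition lc_coeff ::
    "('a, 'n::finite) manifold \<Rightarrow> ('a, 'n) chart \<Rightarrow> 'a metric_field \<Rightarrow> 'n \<Rightarrow> 'n \<Rightarrow> 'n \<Rightarrow> 'a \<Rightarrow> real" where
  "lc_coeff M c g a b d p =
     1 / 2 * (\<Sum>n\<in>UNIV. matrix_inv (metric_comp M c g p) $ a $ n *
       (partial c d (\<lambda>q. metric_comp M c g q $ n $ b) p
        + partial c b (\<lambda>q. metric_comp M c g q $ n $ d) p
        - partial c n (\<lambda>q. metric_comp M c g q $ b $ d) p))"

text \<open>Covariant derivatives with respect to the Levi-Civita connection of \<open>g\<close>: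
  \<open>cov_deriv_02 M c g h a b d\<close> is \<open>h\<^sub>a\<^sub>b\<^sub>;\<^sub>d\<close> and
  \<open>cov_deriv_12 M c g T a b e d\<close> is \<open>T\<^sup>a\<^sub>b\<^sub>e\<^sub>;\<^sub>d\<close>.\<close>

definition cov_deriv_02 ::
    "('a, 'n::finite) manifold \<Rightarrow> ('a, 'n) chart \<Rightarrow> 'a metric_field \<Rightarrow>
     ('n \<Rightarrow> 'n \<Rightarrow> 'a \<Rightarrow> real) \<Rightarrow> 'n \<Rightarrow> 'n \<Rightarrow> 'n \<Rightarrow> 'a \<Rightarrow> real" where
  "cov_deriv_02 M c g h a b d p =
     partial c d (h a b) p
     - (\<Sum>s\<in>UNIV. lc_coeff M c g s d a p * h s b p)
     - (\<Sum>s\<in>UNIV. lc_coeff M c g s d b p * h a s p)"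

definition cov_deriv_12 ::
    "('a, 'n::finite) manifold \<Rightarrow> ('a, 'n) chart \<Rightarrow> 'a metric_field \<Rightarrow>
     ('n \<Rightarrow> 'n \<Rightarrow> 'n \<Rightarrow> 'a \<Rightarrow> real) \<Rightarrow> 'n \<Rightarrow> 'n \<Rightarrow> 'n \<Rightarrow> 'n \<Rightarrow> 'a \<Rightarrow> real" where
  "cov_deriv_12 M c g T a b e d p =
     partial c d (T a b e) p
     + (\<Sum>s\<in>UNIV. lc_coeff M c g a d s p * T s b e p)
     - (\<Sum>s\<in>UNIV. lc_coeff M c g s d b p * T a s e p)
     - (\<Sum>s\<in>UNIV. lc_coeff M c g s d e p * T a b s p)"

text \<open>\<open>rel_christoffel M c g m a b d\<close> is \<open>\<Gamma>\<^sup>a\<^sub>b\<^sub>d(g,m)\<close>.\<close>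

definition rel_christoffel ::
    "('a, 'n::finite) manifold \<Rightarrow> ('a, 'n) chart \<Rightarrow> 'a metric_field \<Rightarrow> 'a metric_field \<Rightarrow>
     'n \<Rightarrow> 'n \<Rightarrow> 'n \<Rightarrow> 'a \<Rightarrow> real" where
  "rel_christoffel M c g m a b d p =
     (let mc = (\<lambda>i j q. metric_comp M c m q $ i $ j) in
      1 / 2 * (\<Sum>n\<in>UNIV. matrix_inv (metric_comp M c m p) $ a $ n *
        (cov_deriv_02 M c g mc n b d p + cov_deriv_02 M c g mc n d b p
         - cov_deriv_02 M c g mc b d n p)))"

text \<open>\<open>rel_curvature M c g m l i j k\<close> is \<open>R\<^sup>l\<^sub>i\<^sub>j\<^sub>k(g,m)\<close>.\<close>

definition rel_curvature ::
    "('a, 'n::finite) manifold \<Rightarrow> ('a, 'n) chart \<Rightarrow> 'a metric_field \<Rightarrow> 'a metric_field \<Rightarrow>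
     'n \<Rightarrow> 'n \<Rightarrow> 'n \<Rightarrow> 'n \<Rightarrow> 'a \<Rightarrow> real" where
  "rel_curvature M c g m l i j k p =
     (let \<Gamma> = rel_christoffel M c g m in
      cov_deriv_12 M c g \<Gamma> l i k j p - cov_deriv_12 M c g \<Gamma> l i j k p
      + (\<Sum>s\<in>UNIV. \<Gamma> l j s p * \<Gamma> s i k p) - (\<Sum>s\<in>UNIV. \<Gamma> l k s p * \<Gamma> s i j p))"


section \<open>Checks of the definitions\<close>

lemma frechet_derivative_cong_open:
  assumes "open S" "x \<in> S" "\<And>y. y \<in> S \<Longrightarrow> f y = h y"
  shows "frechet_derivative f (at x) = frechet_derivative h (at x)"
proof -
  have "(f has_derivative f') (at x) \<longleftrightarrow> (h has_derivative f') (at x)" for f'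
  proof
    assume "(f has_derivative f') (at x)"
    then show "(h has_derivative f') (at x)"
      by (rule has_derivative_transform_within_open[OF _ assms(1,2)]) (rule assms(3))
  next
    assume "(h has_derivative f') (at x)"
    then show "(f has_derivative f') (at x)"
      by (rule has_derivative_transform_within_open[OF _ assms(1,2)]) (rule assms(3)[symmetric])
  qed
  then show ?thesis by (simp add: frechet_derivative_def)
qed

lemma Ck_on_cong:
  assumes S: "open S"
  shows "Ck_on k S f \<Longrightarrow> (\<And>y. y \<in> S \<Longrightarrow> f y = h y) \<Longrightarrow> Ck_on k S h"
proof (induction k arbitrary: f h)
  case 0
  then show ?case using continuous_on_cong[of S S f h] by simp
next
  case (Suc k)
  have fd: "frechet_derivative f (at x) = frechet_derivative h (at x)" if "x \<in> S" for x
    using frechet_derivative_cong_open[OF S that] Suc.prems(2) by blast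
  have "h differentiable (at x)" if x: "x \<in> S" for x
  proof -
    have "f differentiable (at x)" using Suc.prems(1) x by simp
    then obtain f' where "(f has_derivative f') (at x)" by (auto simp: differentiable_def)
    then have "(h has_derivative f') (at x)"
      using has_derivative_transform_within_open[OF _ S x] Suc.prems(2) by blast
    then show ?thesis by (auto simp: differentiable_def)
  qed
  moreover have "Ck_on k S (\<lambda>x. frechet_derivative h (at x) v)" for v
  proof (rule Suc.IH)
    show "Ck_on k S (\<lambda>x. frechet_derivative f (at x) v)" using Suc.prems(1) by simp
  qed (simp add: fd)
  ultimately show ?case by simp
qed

lemma Ck_on_component:
  fixes f :: "'e::real_normed_vector \<Rightarrow> real ^ 'n::finite"
  assumes "open S" "Ck_on k S f"
  shows "Ck_on k S (\<lambda>x. f x $ i)"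
  using assms(2)
proof (induction k arbitrary: f)
  case 0
  then show ?case by (auto intro: continuous_intros)
next
  case (Suc k)
  have d: "((\<lambda>x. f x $ i) has_derivative (\<lambda>v. frechet_derivative f (at x) v $ i)) (at x)"
    if "x \<in> S" for x
    using Suc.prems that frechet_derivative_works[of f "at x"]
      bounded_linear.has_derivative[OF bounded_linear_vec_nth] by simp
  have "Ck_on k S (\<lambda>x. frechet_derivative (\<lambda>y. f y $ i) (at x) v)" for v
  proof (rule Ck_on_cong[OF \<open>open S\<close>])
    show "Ck_on k S (\<lambda>x. frechet_derivative f (at x) v $ i)"
      by (rule Suc.IH) (use Suc.prems in simp)
    show "frechet_derivative f (at y) v $ i = frechet_derivative (\<lambda>y. f y $ i) (at y) v"
      if "y \<in> S" for y
      using fun_cong[OF frechet_derivative_at[OF d[OF that]], of v] .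
  qed
  moreover have "(\<lambda>y. f y $ i) differentiable (at x)" if "x \<in> S" for x
    using d[OF that] unfolding differentiable_def by blast
  ultimately show ?case by simp
qed

context
  fixes M :: "('a, 'n::finite) manifold" and c :: "('a, 'n) chart"
  assumes M: "smooth_manifold M" and c: "c \<in> charts M"
begin

lemma chart_facts:
  shows "openin (mtop M) (dom_chart c)" "open (coord_map c ` dom_chart c)"
    "inj_on (coord_map c) (dom_chart c)"
proof -
  have t: "topological_chart (mtop M) c" using c by (simp add: charts_def)
  then show "openin (mtop M) (dom_chart c)" "open (coord_map c ` dom_chart c)"
    by (auto simp: topological_chart_def)
  have "dom_chart c \<subseteq> topspace (mtop M)"
    using t by (simp add: topological_chart_def openin_subset)
  then show "inj_on (coord_map c) (dom_chart c)"
    using t homeomorphic_imp_injective_map[of "subtopology (mtop M) (dom_chart c)" _ "coord_map c"]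
    by (auto simp: topological_chart_def inf.absorb2)
qed

lemma chart_inv_coord_map: "p \<in> dom_chart c \<Longrightarrow> chart_inv c (coord_map c p) = p"
  by (simp add: chart_inv_def inv_into_f_f chart_facts)

lemma coord_map_chart_inv: "x \<in> coord_map c ` dom_chart c \<Longrightarrow> coord_map c (chart_inv c x) = x"
  by (simp add: chart_inv_def f_inv_into_f)

lemma partial_cong:
  assumes "p \<in> dom_chart c" "\<And>q. q \<in> dom_chart c \<Longrightarrow> f q = h q"
  shows "partial c i f p = partial c i h p"
proof -
  have "frechet_derivative (f \<circ> chart_inv c) (at (coord_map c p)) =
      frechet_derivative (h \<circ> chart_inv c) (at (coord_map c p))"
    by (rule frechet_derivative_cong_open[OF chart_facts(2)])
      (use assms in \<open>auto simp: chart_inv_coord_map\<close>)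
  then show ?thesis by (simp add: partial_def)
qed

lemma smooth_near_coordinate:
  assumes "p \<in> dom_chart c"
  shows "smooth_near M p (\<lambda>q. coord_map c q $ i)"
proof -
  have "smooth_on (coord_map d ` (dom_chart d \<inter> dom_chart c))
      ((\<lambda>q. coord_map c q $ i) \<circ> chart_inv d)" if d: "d \<in> atlas M" for d
  proof -
    let ?S = "coord_map d ` (dom_chart d \<inter> dom_chart c)"
    have t: "topological_chart (mtop M) d" using M d by (simp add: smooth_manifold_def)
    have dd: "dom_chart d \<subseteq> topspace (mtop M)"
      using t by (simp add: topological_chart_def openin_subset)
    have "openin (subtopology (mtop M) (dom_chart d)) (dom_chart d \<inter> dom_chart c)"
      using chart_facts(1) by (auto simp: openin_subtopology)
    then have "openin (top_of_set (coord_map d ` dom_chart d)) ?S"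
      using t dd homeomorphic_imp_open_map unfolding topological_chart_def open_map_def by blast
    then have "open ?S"
      using t by (auto simp: topological_chart_def openin_open_eq)
    moreover have "smooth_on ?S (coord_map c \<circ> chart_inv d)"
      using c d by (auto simp: charts_def smooth_compatible_def smooth_transition_def)
    ultimately show ?thesis
      using Ck_on_component[of ?S _ "coord_map c \<circ> chart_inv d" i]
      by (auto simp: smooth_on_def o_def)
  qed
  then show ?thesis
    unfolding smooth_near_def using assms chart_facts(1) by blast
qed

lemma partial_coordinate:
  assumes "p \<in> dom_chart c"
  shows "partial c j (\<lambda>q. coord_map c q $ i) p = (if i = j then 1 else 0)"
proof -
  have "frechet_derivative ((\<lambda>q. coord_map c q $ i) \<circ> chart_inv c) (at (coord_map c p)) =
      frechet_derivative (\<lambda>x::real^'n. x $ i) (at (coord_map c p))"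
    by (rule frechet_derivative_cong_open[OF chart_facts(2)])
      (use assms in \<open>auto simp: coord_map_chart_inv\<close>)
  also have "\<dots> = (\<lambda>x::real^'n. x $ i)"
    by (rule frechet_derivative_at[symmetric])
      (rule bounded_linear_imp_has_derivative[OF bounded_linear_vec_nth])
  finally show ?thesis by (simp add: partial_def axis_def)
qed

theorem metric_comp_coord_euclidean_metric:
  assumes "p \<in> dom_chart c"
  shows "metric_comp M c (coord_euclidean_metric c) p = mat 1"
proof -
  have cv: "coord_vector M c j p (\<lambda>q. coord_map c q $ i) = (if i = j then 1 else 0)" for i j
    using assms by (simp add: coord_vector_def smooth_near_coordinate partial_coordinate)
  have "coord_euclidean_metric c p (coord_vector M c i p) (coord_vector M c j p) =
      (if i = j then 1 else 0)" for i j
  proof -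
    have "(\<Sum>b\<in>UNIV. (if a = b then 1 else 0) * (if a = i then 1 else 0) * (if b = j then 1 else 0)) =
        (if i = j then if a = i then 1 else 0 else (0::real))" for a
    proof -
      have "(\<Sum>b\<in>UNIV. (if a = b then 1 else 0) * (if a = i then 1 else 0) * (if b = j then 1 else 0)) =
          (\<Sum>b\<in>UNIV. if b = a then if i = j \<and> a = i then 1 else 0 else (0::real))"
        by (rule sum.cong) auto
      then show ?thesis by auto
    qed
    then show ?thesis by (simp add: coord_euclidean_metric_def cv)
  qed
  then show ?thesis
    by (simp add: vec_eq_iff metric_comp_def mat_def)
qed

lemma lc_coeff_coord_euclidean_metric:
  assumes "p \<in> dom_chart c"
  shows "lc_coeff M c (coord_euclidean_metric c) a b d p = 0"
proof -
  have "partial c k (\<lambda>q. metric_comp M c (coord_euclidean_metric c) q $ i $ j) p = 0" for i j k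
  proof -
    have "partial c k (\<lambda>q. metric_comp M c (coord_euclidean_metric c) q $ i $ j) p =
        partial c k (\<lambda>q. (mat 1 :: real^'n^'n) $ i $ j) p"
      by (rule partial_cong[OF assms]) (simp add: metric_comp_coord_euclidean_metric)
    then show ?thesis by (simp add: partial_def o_def)
  qed
  then show ?thesis by (simp add: lc_coeff_def)
qed

theorem cov_deriv_coord_euclidean_metric:
  assumes "p \<in> dom_chart c"
  shows "cov_deriv_02 M c (coord_euclidean_metric c) h a b d p = partial c d (h a b) p"
    and "cov_deriv_12 M c (coord_euclidean_metric c) T a b e d p = partial c d (T a b e) p"
  using assms by (simp_all add: cov_deriv_02_def cov_deriv_12_def lc_coeff_coord_euclidean_metric)

theorem rel_christoffel_coord_euclidean_metric:
  assumes "p \<in> dom_chart c"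
  shows "rel_christoffel M c (coord_euclidean_metric c) g a b d p = lc_coeff M c g a b d p"
  by (simp add: rel_christoffel_def lc_coeff_def cov_deriv_coord_euclidean_metric[OF assms])

theorem lc_coeff_unique:
  fixes G :: "'n \<Rightarrow> 'n \<Rightarrow> 'n \<Rightarrow> real"
  assumes p: "p \<in> dom_chart c"
    and sym: "\<And>q. q \<in> dom_chart c \<Longrightarrow> transpose (metric_comp M c g q) = metric_comp M c g q"
    and inv: "invertible (metric_comp M c g p)"
  shows "(\<forall>a b d. G a b d = G a d b) \<and>
      (\<forall>a b d. partial c d (\<lambda>q. metric_comp M c g q $ a $ b) p
         - (\<Sum>s\<in>UNIV. G s d a * metric_comp M c g p $ s $ b)
         - (\<Sum>s\<in>UNIV. G s d b * metric_comp M c g p $ a $ s) = 0)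
    \<longleftrightarrow> (\<forall>a b d. G a b d = lc_coeff M c g a b d p)" (is "?L \<longleftrightarrow> ?R")
proof -
  define A where "A = metric_comp M c g p"
  define B where "B = matrix_inv A"
  define D where "D k i j = partial c k (\<lambda>q. metric_comp M c g q $ i $ j) p" for k i j
  have gs: "metric_comp M c g q $ i $ j = metric_comp M c g q $ j $ i" if "q \<in> dom_chart c" for q i j
    using arg_cong[OF sym[OF that], of "\<lambda>m. m $ j $ i"] by (simp add: transpose_def)
  have As: "A $ i $ j = A $ j $ i" for i j unfolding A_def by (rule gs[OF p])
  have Ds: "D k i j = D k j i" for k i j
    unfolding D_def by (rule partial_cong[OF p]) (rule gs)
  have "A ** B = mat 1 \<and> B ** A = mat 1"
    unfolding B_def matrix_inv_def using inv unfolding invertible_def A_def by (rule someI_ex)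
  then have AB: "(\<Sum>s\<in>UNIV. A $ i $ s * B $ s $ j) = (if i = j then 1 else 0)"
    and BA: "(\<Sum>s\<in>UNIV. B $ i $ s * A $ s $ j) = (if i = j then 1 else 0)" for i j
    by (simp_all add: matrix_matrix_mult_def mat_def vec_eq_iff)
  have kron: "(if P then 1 else 0) * x = (if P then x else 0)" for P and x :: real by simp
  define F where "F n b d = (\<Sum>s\<in>UNIV. A $ n $ s * G s b d)" for n b d
  define K where "K n b d = 1 / 2 * (D d n b + D b n d - D n b d)" for n b d
  have lc: "lc_coeff M c g a b d p = (\<Sum>n\<in>UNIV. B $ a $ n * K n b d)" for a b d
    by (simp add: lc_coeff_def K_def A_def B_def D_def sum_distrib_left algebra_simps)
  have FG: "(\<Sum>n\<in>UNIV. B $ a $ n * F n b d) = G a b d" for a b d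
  proof -
    have "(\<Sum>n\<in>UNIV. B $ a $ n * F n b d) = (\<Sum>n\<in>UNIV. \<Sum>s\<in>UNIV. B $ a $ n * A $ n $ s * G s b d)"
      by (simp add: F_def sum_distrib_left mult.assoc)
    also have "\<dots> = (\<Sum>s\<in>UNIV. (\<Sum>n\<in>UNIV. B $ a $ n * A $ n $ s) * G s b d)"
      by (subst sum.swap) (simp add: sum_distrib_right)
    also have "\<dots> = G a b d" by (simp add: BA kron)
    finally show ?thesis .
  qed
  have KL: "(\<Sum>s\<in>UNIV. A $ n $ s * (\<Sum>k\<in>UNIV. B $ s $ k * K k b d)) = K n b d" for n b d
  proof -
    have "(\<Sum>s\<in>UNIV. A $ n $ s * (\<Sum>k\<in>UNIV. B $ s $ k * K k b d)) =
        (\<Sum>s\<in>UNIV. \<Sum>k\<in>UNIV. A $ n $ s * B $ s $ k * K k b d)"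
      by (simp add: sum_distrib_left mult.assoc)
    also have "\<dots> = (\<Sum>k\<in>UNIV. (\<Sum>s\<in>UNIV. A $ n $ s * B $ s $ k) * K k b d)"
      by (subst sum.swap) (simp add: sum_distrib_right)
    also have "\<dots> = K n b d" by (simp add: AB kron)
    finally show ?thesis .
  qed
  have par: "(partial c d (\<lambda>q. metric_comp M c g q $ a $ b) p
         - (\<Sum>s\<in>UNIV. G s d a * metric_comp M c g p $ s $ b)
         - (\<Sum>s\<in>UNIV. G s d b * metric_comp M c g p $ a $ s) = 0) \<longleftrightarrow>
      D d a b = F b d a + F a d b" for a b d
  proof -
    have "(\<Sum>s\<in>UNIV. G s d a * metric_comp M c g p $ s $ b) = F b d a"
      unfolding F_def by (rule sum.cong) (use As[of b] in \<open>simp_all add: A_def mult.commute\<close>)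
    moreover have "(\<Sum>s\<in>UNIV. G s d b * metric_comp M c g p $ a $ s) = F a d b"
      unfolding F_def by (rule sum.cong) (simp_all add: A_def mult.commute)
    ultimately show ?thesis by (auto simp: D_def)
  qed
  show ?thesis
  proof
    assume L: ?L
    have Fs: "F n b d = F n d b" for n b d unfolding F_def by (rule sum.cong) (use L in auto)
    have Df: "D d a b = F b d a + F a d b" for a b d using L par by blast
    have "F n b d = K n b d" for n b d
      unfolding K_def using Df[of d n b] Df[of b n d] Df[of n b d] Fs[of n b d] Fs[of b n d] Fs[of d n b]
      by (simp add: field_simps)
    then show ?R using FG lc by simp
  next
    assume R: ?R
    have FK: "F n b d = K n b d" for n b d
      unfolding F_def using R lc KL by simp
    have Ks: "K n b d = K n d b" for n b d unfolding K_def using Ds[of n b d] by simp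
    have "G a b d = G a d b" for a b d
      unfolding FG[symmetric] FK by (rule sum.cong) (simp_all add: Ks[of _ b d])
    moreover have "D d a b = F b d a + F a d b" for a b d
      unfolding FK K_def using Ds[of d a b] Ds[of b d a] Ds[of a d b] by (simp add: field_simps)
    ultimately show ?L using par by blast
  qed
qed

end

end

theory Submission
  imports Defs
begin

text \<open>In the chart, \<open>\<Gamma>(g,m) = \<Gamma>(\<delta>,m) - \<Gamma>(\<delta>,g)\<close>: in \<open>m\<^sub>n\<^sub>b\<^sub>;\<^sub>d + m\<^sub>n\<^sub>d\<^sub>;\<^sub>b - m\<^sub>b\<^sub>d\<^sub>;\<^sub>n\<close> the connection terms of \<open>g\<close>
  collapse to \<open>-2 \<Gamma>\<^sup>s\<^sub>b\<^sub>d m\<^sub>n\<^sub>s\<close> by symmetry. Inserting this difference into the definition of the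
  relative curvature, all mixed terms cancel. The analytic input is that the Christoffel symbols
  are differentiable, which holds because Cramer's rule expresses the inverse matrix by
  determinants, and that the component matrices are symmetric and positive definite, which
  requires the coordinate vectors to be derivations.\<close>

section \<open>Closure properties of smooth functions\<close>

text \<open>\<open>Ck_on (Suc k)\<close> does not mention \<open>Ck_on k\<close>. The inclusion
  starts from differentiability giving continuity and descends through all directional
  derivatives.\<close>

lemma Ck_on_Suc_D: "open S \<Longrightarrow> Ck_on (Suc k) S f \<Longrightarrow> Ck_on k S f"
proof (induction k arbitrary: f)
  case 0
  then show ?case
    by (auto intro!: continuous_at_imp_continuous_on differentiable_imp_continuous_within)
next
  case (Suc k)
  then show ?case by simp
qed

lemma Ck_on_subset: "Ck_on k S f \<Longrightarrow> T \<subseteq> S \<Longrightarrow> Ck_on k T f"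
  by (induction k arbitrary: f) (auto intro: continuous_on_subset)

lemma Ck_on_const: "Ck_on k S (\<lambda>x. a)"
  by (induction k arbitrary: a) auto

lemma frechet_derivative_add_fun:
  assumes "f differentiable at x" "h differentiable at x"
  shows "frechet_derivative (\<lambda>x. f x + h x) (at x) v =
    frechet_derivative f (at x) v + frechet_derivative h (at x) v"
proof -
  have "((\<lambda>x. f x + h x) has_derivative
      (\<lambda>v. frechet_derivative f (at x) v + frechet_derivative h (at x) v)) (at x)"
    using assms by (intro has_derivative_add) (simp_all add: frechet_derivative_works)
  from fun_cong[OF frechet_derivative_at[OF this], of v] show ?thesis by simp
qed

lemma Ck_on_add:
  assumes "open S"
  shows "Ck_on k S f \<Longrightarrow> Ck_on k S h \<Longrightarrow> Ck_on k S (\<lambda>x. f x + h x)"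
proof (induction k arbitrary: f h)
  case 0
  then show ?case by (auto intro: continuous_intros)
next
  case (Suc k)
  have d: "f differentiable at x" "h differentiable at x" if "x \<in> S" for x
    using Suc.prems that by auto
  have "Ck_on k S (\<lambda>x. frechet_derivative (\<lambda>x. f x + h x) (at x) v)" for v
  \<comment> \<open>The sum rule for the derivative is available only on \<open>S\<close>, so the
    two functions of \<open>x\<close> are compared there and not as whole functions.\<close>
  proof (rule Ck_on_cong[OF assms])
    show "Ck_on k S (\<lambda>x. frechet_derivative f (at x) v + frechet_derivative h (at x) v)"
      using Suc by simp
    show "frechet_derivative f (at y) v + frechet_derivative h (at y) v =
        frechet_derivative (\<lambda>x. f x + h x) (at y) v" if "y \<in> S" for y
      by (simp add: frechet_derivative_add_fun d that)
  qed
  then show ?case using d by (auto intro: derivative_intros)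
qed

lemma frechet_derivative_mult_real:
  fixes f h :: "'e::real_normed_vector \<Rightarrow> real"
  assumes "f differentiable at x" "h differentiable at x"
  shows "frechet_derivative (\<lambda>x. f x * h x) (at x) v =
    frechet_derivative f (at x) v * h x + f x * frechet_derivative h (at x) v"
proof -
  have "((\<lambda>x. f x * h x) has_derivative
      (\<lambda>v. f x * frechet_derivative h (at x) v + frechet_derivative f (at x) v * h x)) (at x)"
    using assms by (intro has_derivative_mult) (simp_all add: frechet_derivative_works)
  from fun_cong[OF frechet_derivative_at[OF this], of v] show ?thesis by simp
qed

lemma Ck_on_mult:
  fixes f h :: "'e::real_normed_vector \<Rightarrow> real"
  assumes "open S"
  shows "Ck_on k S f \<Longrightarrow> Ck_on k S h \<Longrightarrow> Ck_on k S (\<lambda>x. f x * h x)"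
proof (induction k arbitrary: f h)
  case 0
  then show ?case by (auto intro: continuous_intros)
next
  case (Suc k)
  have d: "f differentiable at x" "h differentiable at x" if "x \<in> S" for x
    using Suc.prems that by auto
  \<comment> \<open>Leibniz's rule leaves one factor of each product undifferentiated, so the
    induction step also needs \<open>f\<close> and \<open>h\<close> themselves at level
    \<open>k\<close>.\<close>
  have k: "Ck_on k S f" "Ck_on k S h"
    using Suc.prems Ck_on_Suc_D[OF assms] by blast+
  have "Ck_on k S (\<lambda>x. frechet_derivative (\<lambda>x. f x * h x) (at x) v)" for v
  proof (rule Ck_on_cong[OF assms])
    show "Ck_on k S (\<lambda>x. frechet_derivative f (at x) v * h x + f x * frechet_derivative h (at x) v)"
      using Suc k by (intro Ck_on_add[OF assms] Suc.IH) simp_all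
    show "frechet_derivative f (at y) v * h y + f y * frechet_derivative h (at y) v =
        frechet_derivative (\<lambda>x. f x * h x) (at y) v" if "y \<in> S" for y
      by (simp add: frechet_derivative_mult_real d that)
  qed
  then show ?case using d by (auto intro: derivative_intros)
qed

section \<open>Germs of smooth functions on the manifold\<close>

lemma topological_chart_open_image:
  assumes t: "topological_chart X d" and W: "openin X W"
  shows "open (coord_map d ` (dom_chart d \<inter> W))"
proof -
  have dd: "dom_chart d \<subseteq> topspace X"
    using t by (simp add: topological_chart_def openin_subset)
  have "openin (subtopology X (dom_chart d)) (dom_chart d \<inter> W)"
    using W by (auto simp: openin_subtopology)
  then have "openin (top_of_set (coord_map d ` dom_chart d)) (coord_map d ` (dom_chart d \<inter> W))"
    using t dd homeomorphic_imp_open_map unfolding topological_chart_def open_map_def by blast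
  then show ?thesis
    using t by (auto simp: topological_chart_def openin_open_eq)
qed

text \<open>One argument serves sums, products and multiples: intersect the two neighbourhoods and
  work in each atlas chart. The hypothesis \<open>op\<close> ranges over all open sets because the
  image of the intersection changes with the chart.\<close>

lemma smooth_near_combine:
  fixes M :: "('a, 'n::finite) manifold"
  assumes M: "smooth_manifold M"
    and f: "smooth_near M p f" and h: "smooth_near M p h"
    and op: "\<And>k (S :: (real ^ 'n) set) F H. open S \<Longrightarrow> Ck_on k S F \<Longrightarrow> Ck_on k S H \<Longrightarrow> Ck_on k S (\<lambda>x. b (F x) (H x))"
  shows "smooth_near M p (\<lambda>q. b (f q) (h q))"
proof -
  obtain V where V: "openin (mtop M) V" "p \<in> V"
      "\<And>d. d \<in> atlas M \<Longrightarrow> smooth_on (coord_map d ` (dom_chart d \<inter> V)) (f \<circ> chart_inv d)"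
    using f unfolding smooth_near_def by blast
  obtain W where W: "openin (mtop M) W" "p \<in> W"
      "\<And>d. d \<in> atlas M \<Longrightarrow> smooth_on (coord_map d ` (dom_chart d \<inter> W)) (h \<circ> chart_inv d)"
    using h unfolding smooth_near_def by blast
  have "smooth_on (coord_map d ` (dom_chart d \<inter> (V \<inter> W))) ((\<lambda>q. b (f q) (h q)) \<circ> chart_inv d)"
    if d: "d \<in> atlas M" for d
  proof -
    let ?S = "coord_map d ` (dom_chart d \<inter> (V \<inter> W))"
    have "open ?S"
      using M d V W by (intro topological_chart_open_image[of "mtop M"])
        (auto simp: smooth_manifold_def)
    moreover have "Ck_on k ?S (f \<circ> chart_inv d)" for k
      using V(3)[OF d] by (auto simp: smooth_on_def intro: Ck_on_subset)
    moreover have "Ck_on k ?S (h \<circ> chart_inv d)" for k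
      using W(3)[OF d] by (auto simp: smooth_on_def intro: Ck_on_subset)
    ultimately show ?thesis
      using op[of ?S _ "f \<circ> chart_inv d" "h \<circ> chart_inv d"] by (simp add: smooth_on_def comp_def)
  qed
  then show ?thesis
    unfolding smooth_near_def using V W by (intro exI[of _ "V \<inter> W"]) auto
qed

lemma smooth_near_add:
  "smooth_manifold M \<Longrightarrow> smooth_near M p f \<Longrightarrow> smooth_near M p h \<Longrightarrow>
    smooth_near M p (\<lambda>q. f q + h q)"
  by (rule smooth_near_combine) (auto intro: Ck_on_add)

lemma smooth_near_mult:
  "smooth_manifold M \<Longrightarrow> smooth_near M p f \<Longrightarrow> smooth_near M p h \<Longrightarrow>
    smooth_near M p (\<lambda>q. f q * h q)"
  by (rule smooth_near_combine) (auto intro: Ck_on_mult)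

lemma smooth_near_scale:
  "smooth_manifold M \<Longrightarrow> smooth_near M p f \<Longrightarrow> smooth_near M p (\<lambda>q. r * f q)"
  \<comment> \<open>Scaling is treated as a binary operation that ignores its second
    argument.\<close>
  by (rule smooth_near_combine[of M p f f "\<lambda>x y. r * x"]) (auto intro: Ck_on_mult Ck_on_const)


section \<open>Tangent spaces\<close>

lemma tangent_space_lincomb:
  assumes "u \<in> tangent_space M p" "v \<in> tangent_space M p"
  shows "(\<lambda>f. r * u f + s * v f) \<in> tangent_space M p"
  unfolding tangent_space_def mem_Collect_eq
proof (intro conjI allI impI)
  fix f h assume fh: "smooth_near M p f" "smooth_near M p h"
  show "r * u (\<lambda>q. f q + h q) + s * v (\<lambda>q. f q + h q) =
      (r * u f + s * v f) + (r * u h + s * v h)"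
    "r * u (\<lambda>q. f q * h q) + s * v (\<lambda>q. f q * h q) =
      (r * u f + s * v f) * h p + f p * (r * u h + s * v h)"
    using assms fh unfolding tangent_space_def mem_Collect_eq by (simp_all add: algebra_simps)
  assume eq: "\<exists>W. openin (mtop M) W \<and> p \<in> W \<and> (\<forall>q\<in>W. f q = h q)"
  have "u f = u h" "v f = v h"
    using assms fh eq unfolding tangent_space_def mem_Collect_eq by metis+
  then show "r * u f + s * v f = r * u h + s * v h" by simp
next
  fix t f assume "smooth_near M p f"
  then show "r * u (\<lambda>q. t * f q) + s * v (\<lambda>q. t * f q) = t * (r * u f + s * v f)"
    using assms unfolding tangent_space_def mem_Collect_eq by (simp add: algebra_simps)
next
  fix f assume "\<not> smooth_near M p f"
  then show "r * u f + s * v f = 0"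
    using assms unfolding tangent_space_def mem_Collect_eq by simp
qed

text \<open>The member \<open>u\<close> supplies the zero derivation as
  \<open>0 * u + 0 * u\<close>, which is the value of an empty sum and, by convention, of a sum over
  an infinite set.\<close>

lemma tangent_space_sum:
  assumes "\<And>a. a \<in> I \<Longrightarrow> e a \<in> tangent_space M p"
    and "u \<in> tangent_space M p"
  shows "(\<lambda>f. \<Sum>a\<in>I. x a * e a f) \<in> tangent_space M p"
  using assms(1)
proof (induction I rule: infinite_finite_induct)
  case (insert a I)
  then show ?case
    using tangent_space_lincomb[of "e a" M p "\<lambda>f. \<Sum>a\<in>I. x a * e a f" "x a" 1] by simp
qed (use tangent_space_lincomb[OF assms(2,2), of 0 0] in simp_all)


section \<open>Calculus in a chart\<close>

context
  fixes M :: "('a, 'n::finite) manifold" and c :: "('a, 'n) chart"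
  assumes M: "smooth_manifold M" and c: "c \<in> charts M"
begin

lemma dom_chart_topspace: "p \<in> dom_chart c \<Longrightarrow> p \<in> topspace (mtop M)"
  using chart_facts(1)[OF M c] openin_subset by blast

text \<open>Differentiability at a single point is what the sum and product rules for
  \<open>partial\<close> require, and it passes easily through determinants and quotients.\<close>

definition chart_diff :: "('a \<Rightarrow> real) \<Rightarrow> 'a \<Rightarrow> bool" where
  "chart_diff f p \<longleftrightarrow> (f \<circ> chart_inv c) differentiable at (coord_map c p)"

text \<open>Smoothness near \<open>p\<close> is tested in charts of the atlas, while
  \<open>c\<close> may lie only in the maximal atlas. The chain rule through an atlas chart
  \<open>d\<close> around \<open>p\<close> and the transition map from \<open>c\<close> to
  \<open>d\<close> bridges the gap.\<close>

lemma smooth_near_chart_diff: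
  assumes p: "p \<in> dom_chart c" and f: "smooth_near M p f"
  shows "chart_diff f p"
proof -
  obtain W where W: "openin (mtop M) W" "p \<in> W"
      "\<And>d. d \<in> atlas M \<Longrightarrow> smooth_on (coord_map d ` (dom_chart d \<inter> W)) (f \<circ> chart_inv d)"
    using f unfolding smooth_near_def by blast
  obtain d where d: "d \<in> atlas M" "p \<in> dom_chart d"
    using M dom_chart_topspace[OF p] unfolding smooth_manifold_def by blast
  have td: "topological_chart (mtop M) d" and tc: "topological_chart (mtop M) c"
    using M d c by (auto simp: smooth_manifold_def charts_def)
  have dc: "d \<in> charts M"
    using M d by (auto simp: smooth_manifold_def charts_def)
  have st: "smooth_on (coord_map c ` (dom_chart c \<inter> dom_chart d)) (coord_map d \<circ> chart_inv c)"
    using c d by (auto simp: charts_def smooth_compatible_def smooth_transition_def)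
  have pp: "chart_inv c (coord_map c p) = p" using chart_inv_coord_map[OF M c p] .
  have 1: "(coord_map d \<circ> chart_inv c) differentiable at (coord_map c p)"
    using st[unfolded smooth_on_def, rule_format, of "Suc 0"] p d(2) by simp
  have 2: "(f \<circ> chart_inv d) differentiable at ((coord_map d \<circ> chart_inv c) (coord_map c p))"
    using W(3)[OF d(1), unfolded smooth_on_def, rule_format, of "Suc 0"] W(2) d(2) pp
    by simp
  obtain D where D: "((f \<circ> chart_inv d \<circ> (coord_map d \<circ> chart_inv c)) has_derivative D)
      (at (coord_map c p))"
    using differentiable_chain_at[OF 1 2] unfolding differentiable_def by blast
  have "(f \<circ> chart_inv c has_derivative D) (at (coord_map c p))"
  proof (rule has_derivative_transform_within_open[OF D])
    show "open (coord_map c ` (dom_chart c \<inter> dom_chart d))"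
      using topological_chart_open_image[OF tc] chart_facts(1)[OF M dc] .
    show "coord_map c p \<in> coord_map c ` (dom_chart c \<inter> dom_chart d)" using p d by auto
    show "(f \<circ> chart_inv d \<circ> (coord_map d \<circ> chart_inv c)) x = (f \<circ> chart_inv c) x"
      if "x \<in> coord_map c ` (dom_chart c \<inter> dom_chart d)" for x
      using that chart_inv_coord_map[OF M c] chart_inv_coord_map[OF M dc] by auto
  qed
  then show ?thesis by (auto simp: chart_diff_def differentiable_def)
qed

lemma chart_diff_cong:
  assumes p: "p \<in> dom_chart c" and f: "chart_diff f p"
    and eq: "\<And>q. q \<in> dom_chart c \<Longrightarrow> f q = h q"
  shows "chart_diff h p"
proof -
  obtain D where "((f \<circ> chart_inv c) has_derivative D) (at (coord_map c p))"
    using f by (auto simp: chart_diff_def differentiable_def)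
  then have "((h \<circ> chart_inv c) has_derivative D) (at (coord_map c p))"
    by (rule has_derivative_transform_within_open[OF _ chart_facts(2)[OF M c]])
      (use p eq in \<open>auto simp: chart_inv_coord_map[OF M c]\<close>)
  then show ?thesis by (auto simp: chart_diff_def differentiable_def)
qed

lemma chart_diff_const: "chart_diff (\<lambda>q. a) p"
  by (simp add: chart_diff_def comp_def)

lemma chart_diff_add: "chart_diff f p \<Longrightarrow> chart_diff h p \<Longrightarrow> chart_diff (\<lambda>q. f q + h q) p"
  by (simp add: chart_diff_def comp_def)

lemma chart_diff_diff: "chart_diff f p \<Longrightarrow> chart_diff h p \<Longrightarrow> chart_diff (\<lambda>q. f q - h q) p"
  by (simp add: chart_diff_def comp_def)

lemma chart_diff_mult: "chart_diff f p \<Longrightarrow> chart_diff h p \<Longrightarrow> chart_diff (\<lambda>q. f q * h q) p"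
  by (simp add: chart_diff_def comp_def)

lemma chart_diff_divide:
  "chart_diff f p \<Longrightarrow> chart_diff h p \<Longrightarrow> p \<in> dom_chart c \<Longrightarrow> h p \<noteq> 0 \<Longrightarrow>
    chart_diff (\<lambda>q. f q / h q) p"
  by (simp add: chart_diff_def comp_def chart_inv_coord_map[OF M c])

lemma chart_diff_sum:
  "(\<And>a. a \<in> I \<Longrightarrow> chart_diff (f a) p) \<Longrightarrow> chart_diff (\<lambda>q. \<Sum>a\<in>I. f a q) p"
  by (induction I rule: infinite_finite_induct) (auto intro: chart_diff_const chart_diff_add)

lemma chart_diff_prod:
  "(\<And>a. a \<in> I \<Longrightarrow> chart_diff (f a) p) \<Longrightarrow> chart_diff (\<lambda>q. \<Prod>a\<in>I. f a q) p"
  by (induction I rule: infinite_finite_induct) (auto intro: chart_diff_const chart_diff_mult)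

text \<open>By the Leibniz formula the determinant is a polynomial in the entries.\<close>

lemma chart_diff_det:
  fixes A :: "'a \<Rightarrow> real ^ 'k ^ 'k"
  assumes "\<And>i j. chart_diff (\<lambda>q. A q $ i $ j) p"
  shows "chart_diff (\<lambda>q. det (A q)) p"
  unfolding det_def
  by (intro chart_diff_sum chart_diff_mult chart_diff_const chart_diff_prod assms)

section \<open>Partial derivatives and coordinate vectors\<close>

lemma partial_add:
  "chart_diff f p \<Longrightarrow> chart_diff h p \<Longrightarrow>
    partial c i (\<lambda>q. f q + h q) p = partial c i f p + partial c i h p"
  by (simp add: partial_def chart_diff_def comp_def frechet_derivative_add_fun)

lemma partial_mult:
  "chart_diff f p \<Longrightarrow> chart_diff h p \<Longrightarrow> p \<in> dom_chart c \<Longrightarrow>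
    partial c i (\<lambda>q. f q * h q) p = partial c i f p * h p + f p * partial c i h p"
  by (simp add: partial_def chart_diff_def comp_def frechet_derivative_mult_real
      chart_inv_coord_map[OF M c])

lemma partial_scale:
  "chart_diff f p \<Longrightarrow> p \<in> dom_chart c \<Longrightarrow> partial c i (\<lambda>q. r * f q) p = r * partial c i f p"
  using partial_mult[of "\<lambda>q. r" p f i]
  by (simp add: chart_diff_const) (simp add: partial_def comp_def)

lemma partial_diff:
  "chart_diff f p \<Longrightarrow> chart_diff h p \<Longrightarrow> p \<in> dom_chart c \<Longrightarrow>
    partial c i (\<lambda>q. f q - h q) p = partial c i f p - partial c i h p"
  using partial_add[of f p "\<lambda>q. - 1 * h q" i] partial_scale[of h p i "- 1"]
    chart_diff_mult[OF chart_diff_const[of "- 1"], of h p]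
  by simp

text \<open>Agreement on any neighbourhood of \<open>p\<close> suffices here, which is the germ
  condition in \<open>tangent_space\<close>.\<close>

lemma partial_cong_near:
  assumes p: "p \<in> dom_chart c" and W: "openin (mtop M) W" "p \<in> W" "\<And>q. q \<in> W \<Longrightarrow> f q = h q"
  shows "partial c i f p = partial c i h p"
proof -
  have "frechet_derivative (f \<circ> chart_inv c) (at (coord_map c p)) =
      frechet_derivative (h \<circ> chart_inv c) (at (coord_map c p))"
  proof (rule frechet_derivative_cong_open)
    show "open (coord_map c ` (dom_chart c \<inter> W))"
      using c W by (intro topological_chart_open_image[of "mtop M"]) (auto simp: charts_def)
    show "coord_map c p \<in> coord_map c ` (dom_chart c \<inter> W)" using p W by auto
    show "(f \<circ> chart_inv c) x = (h \<circ> chart_inv c) x"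
      if "x \<in> coord_map c ` (dom_chart c \<inter> W)" for x
      using that W(3) chart_inv_coord_map[OF M c] by auto
  qed
  then show ?thesis by (simp add: partial_def)
qed

text \<open>The axioms of \<open>riemannian_metric\<close> speak only about members of
  \<open>tangent_space\<close>, so this membership gives access to symmetry, linearity and
  positivity for the components.\<close>

lemma coord_vector_tangent:
  assumes p: "p \<in> dom_chart c"
  shows "coord_vector M c i p \<in> tangent_space M p"
  unfolding tangent_space_def mem_Collect_eq
proof (intro conjI allI impI)
  fix f h assume f: "smooth_near M p f" and h: "smooth_near M p h"
  note d = smooth_near_chart_diff[OF p f] smooth_near_chart_diff[OF p h]
  show "coord_vector M c i p (\<lambda>q. f q + h q) = coord_vector M c i p f + coord_vector M c i p h"
    using f h d by (simp add: coord_vector_def smooth_near_add[OF M] partial_add)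
  show "coord_vector M c i p (\<lambda>q. f q * h q) =
      coord_vector M c i p f * h p + f p * coord_vector M c i p h"
    using f h d p by (simp add: coord_vector_def smooth_near_mult[OF M] partial_mult)
  assume "\<exists>W. openin (mtop M) W \<and> p \<in> W \<and> (\<forall>q\<in>W. f q = h q)"
  then obtain W where "openin (mtop M) W" "p \<in> W" "\<And>q. q \<in> W \<Longrightarrow> f q = h q" by blast
  then have "partial c i f p = partial c i h p" by (rule partial_cong_near[OF p])
  then show "coord_vector M c i p f = coord_vector M c i p h"
    using f h by (simp add: coord_vector_def)
next
  fix r f assume f: "smooth_near M p f"
  show "coord_vector M c i p (\<lambda>q. r * f q) = r * coord_vector M c i p f"
    using f p smooth_near_chart_diff[OF p f]
    by (simp add: coord_vector_def smooth_near_scale[OF M] partial_scale)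
qed (simp add: coord_vector_def)

lemma coord_vector_coordinate:
  "p \<in> dom_chart c \<Longrightarrow> coord_vector M c j p (\<lambda>q. coord_map c q $ i) = (if i = j then 1 else 0)"
  by (simp add: coord_vector_def smooth_near_coordinate[OF M c] partial_coordinate[OF M c])


section \<open>Components of Riemannian metrics\<close>

context
  fixes g :: "'a metric_field"
  assumes g: "riemannian_metric M g"
begin

lemma metric_sym:
  assumes "p \<in> dom_chart c" "v \<in> tangent_space M p" "w \<in> tangent_space M p"
  shows "g p v w = g p w v"
  using g dom_chart_topspace[OF assms(1)] assms(2-) unfolding riemannian_metric_def by blast

lemma metric_comp_sym:
  "p \<in> dom_chart c \<Longrightarrow> metric_comp M c g p $ a $ b = metric_comp M c g p $ b $ a"
  using metric_sym[OF _ coord_vector_tangent coord_vector_tangent] by (simp add: metric_comp_def)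

lemma metric_linear_left:
  assumes "p \<in> dom_chart c" "u \<in> tangent_space M p" "v \<in> tangent_space M p" "w \<in> tangent_space M p"
  shows "g p (\<lambda>f. r * u f + s * v f) w = r * g p u w + s * g p v w"
  using g dom_chart_topspace[OF assms(1)] assms(2-) unfolding riemannian_metric_def by blast

lemma metric_sum_left:
  assumes p: "p \<in> dom_chart c" and w: "w \<in> tangent_space M p"
  shows "g p (\<lambda>f. \<Sum>a\<in>I. x a * coord_vector M c a p f) w =
    (\<Sum>a\<in>I. x a * g p (coord_vector M c a p) w)"
proof (induction I rule: infinite_finite_induct)
  case (insert a I)
  have "(\<lambda>f. \<Sum>a\<in>I. x a * coord_vector M c a p f) \<in> tangent_space M p"
    by (rule tangent_space_sum) (rule coord_vector_tangent[OF p])+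
  from metric_linear_left[OF p coord_vector_tangent[OF p, of a] this w, of "x a" 1] insert
  show ?case by simp
\<comment> \<open>The metric vanishes on the zero derivation, written as
  \<open>0 * w + 0 * w\<close>.\<close>
qed (use metric_linear_left[OF p w w w, of 0 0] in simp_all)

text \<open>The quadratic form is \<open>g p v v\<close> for the tangent vector \<open>v\<close>
  with coefficients \<open>x\<close> in the coordinate basis. This \<open>v\<close> is nonzero
  because evaluating it on the coordinate functions recovers \<open>x\<close>.\<close>

lemma metric_comp_pos:
  assumes p: "p \<in> dom_chart c" and x: "x \<noteq> 0"
  shows "x \<bullet> (metric_comp M c g p *v x) > 0"
proof -
  define v where "v = (\<lambda>f. \<Sum>a\<in>UNIV. x $ a * coord_vector M c a p f)"
  have v: "v \<in> tangent_space M p"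
    unfolding v_def by (rule tangent_space_sum) (rule coord_vector_tangent[OF p])+
  have vx: "v (\<lambda>q. coord_map c q $ i) = x $ i" for i
    by (simp add: v_def coord_vector_coordinate[OF p] if_distrib cong: if_cong)
  have "v \<noteq> (\<lambda>f. 0)"
  proof
    assume "v = (\<lambda>f. 0)"
    then have "x $ i = 0" for i using vx[of i] by simp
    then show False using x by (simp add: vec_eq_iff)
  qed
  then have "g p v v > 0"
    using g dom_chart_topspace[OF p] v unfolding riemannian_metric_def by blast
  also have "g p v v = (\<Sum>a\<in>UNIV. x $ a * g p (coord_vector M c a p) v)"
    using metric_sum_left[OF p v, of "\<lambda>a. x $ a" UNIV] by (simp add: v_def)
  also have "\<dots> = (\<Sum>a\<in>UNIV. x $ a * (\<Sum>b\<in>UNIV. x $ b * metric_comp M c g p $ b $ a))"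
  proof (rule sum.cong[OF refl])
    fix a
    have "g p (coord_vector M c a p) v = g p v (coord_vector M c a p)"
      by (rule metric_sym[OF p coord_vector_tangent[OF p] v])
    also have "\<dots> = (\<Sum>b\<in>UNIV. x $ b * metric_comp M c g p $ b $ a)"
      using metric_sum_left[OF p coord_vector_tangent[OF p, of a], of "\<lambda>a. x $ a" UNIV]
      by (simp add: v_def metric_comp_def)
    finally show "x $ a * g p (coord_vector M c a p) v =
      x $ a * (\<Sum>b\<in>UNIV. x $ b * metric_comp M c g p $ b $ a)" by simp
  qed
  also have "\<dots> = x \<bullet> (metric_comp M c g p *v x)"
    by (simp add: inner_vec_def matrix_vector_mult_def metric_comp_sym[OF p] mult.commute)
  finally show ?thesis .
qed

text \<open>A positive definite matrix has trivial kernel.\<close>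

lemma metric_comp_invertible:
  assumes p: "p \<in> dom_chart c"
  shows "invertible (metric_comp M c g p)"
proof -
  have "x = 0" if "metric_comp M c g p *v x = 0" for x
    using metric_comp_pos[OF p, of x] that by auto
  then show ?thesis
    by (simp add: invertible_left_inverse matrix_left_invertible_ker)
qed

lemma matrix_inv_metric_comp:
  assumes p: "p \<in> dom_chart c"
  shows "matrix_inv (metric_comp M c g p) ** metric_comp M c g p = mat 1"
    and "metric_comp M c g p ** matrix_inv (metric_comp M c g p) = mat 1"
proof -
  have "metric_comp M c g p ** matrix_inv (metric_comp M c g p) = mat 1 \<and>
      matrix_inv (metric_comp M c g p) ** metric_comp M c g p = mat 1"
    unfolding matrix_inv_def
    using metric_comp_invertible[OF p] unfolding invertible_def by (rule someI_ex)
  then show "matrix_inv (metric_comp M c g p) ** metric_comp M c g p = mat 1"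
    and "metric_comp M c g p ** matrix_inv (metric_comp M c g p) = mat 1"
    by auto
qed

lemma chart_diff_metric_comp:
  assumes p: "p \<in> dom_chart c"
  shows "chart_diff (\<lambda>q. metric_comp M c g q $ a $ b) p"
proof -
  have "smooth_on (coord_map c ` dom_chart c) ((\<lambda>p. metric_comp M c g p $ a $ b) \<circ> chart_inv c)"
    using g c by (auto simp: riemannian_metric_def)
  from this[unfolded smooth_on_def, rule_format, of "Suc 0"] p show ?thesis
    by (simp add: chart_diff_def)
qed

lemma chart_diff_partial_metric_comp:
  assumes p: "p \<in> dom_chart c"
  shows "chart_diff (partial c k (\<lambda>q. metric_comp M c g q $ a $ b)) p"
proof -
  let ?f = "(\<lambda>p. metric_comp M c g p $ a $ b) \<circ> chart_inv c"
  have "smooth_on (coord_map c ` dom_chart c) ?f"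
    using g c by (auto simp: riemannian_metric_def)
  \<comment> \<open>Level two makes every first directional derivative differentiable in
    turn.\<close>
  from this[unfolded smooth_on_def, rule_format, of "Suc (Suc 0)"] p
  have "(\<lambda>x. frechet_derivative ?f (at x) (axis k 1)) differentiable at (coord_map c p)" by simp
  then obtain D where "((\<lambda>x. frechet_derivative ?f (at x) (axis k 1)) has_derivative D)
      (at (coord_map c p))"
    by (auto simp: differentiable_def)
  then have "(partial c k (\<lambda>q. metric_comp M c g q $ a $ b) \<circ> chart_inv c has_derivative D)
      (at (coord_map c p))"
    by (rule has_derivative_transform_within_open[OF _ chart_facts(2)[OF M c]])
      (use p in \<open>auto simp: partial_def chart_inv_coord_map[OF M c]\<close>)
  then show ?thesis by (auto simp: chart_diff_def differentiable_def)
qed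

text \<open>Cramer's rule writes each entry of the inverse as a quotient of determinants. The
  formula is established on the chart domain, where the metric is invertible;
  \<open>chart_diff_cong\<close> asks for no more.\<close>

lemma chart_diff_matrix_inv_metric_comp:
  assumes p: "p \<in> dom_chart c"
  shows "chart_diff (\<lambda>q. matrix_inv (metric_comp M c g q) $ a $ b) p"
proof (rule chart_diff_cong[OF p])
  let ?A = "metric_comp M c g"
  \<comment> \<open>Column \<open>a\<close> of the component matrix is replaced by the basis vector
    with index \<open>b\<close>.\<close>
  let ?B = "\<lambda>q. (\<chi> i j. if j = a then axis b 1 $ i else ?A q $ i $ j) :: real ^ 'n ^ 'n"
  have det: "det (?A q) \<noteq> 0" if "q \<in> dom_chart c" for q
    using metric_comp_invertible[OF that] by (simp add: invertible_det_nz)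
  have "chart_diff (\<lambda>q. ?B q $ i $ j) p" for i j
    by (cases "j = a") (simp_all add: chart_diff_const chart_diff_metric_comp[OF p])
  then show "chart_diff (\<lambda>q. det (?B q) / det (?A q)) p"
    using p by (intro chart_diff_divide chart_diff_det chart_diff_metric_comp det)
  show "det (?B q) / det (?A q) = matrix_inv (?A q) $ a $ b" if q: "q \<in> dom_chart c" for q
  proof -
    \<comment> \<open>Column \<open>b\<close> of the inverse solves the linear system with this
      basis vector as right-hand side; its coordinate \<open>a\<close> is the wanted entry.\<close>
    have "?A q *v (matrix_inv (?A q) *v axis b 1) = axis b 1"
      by (simp add: matrix_vector_mul_assoc matrix_inv_metric_comp[OF q])
    then have "matrix_inv (?A q) *v axis b 1 =
        (\<chi> k. det (\<chi> i j. if j = k then axis b 1 $ i else ?A q $ i $ j) / det (?A q))"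
      using cramer[OF det[OF q]] by blast
    then have "(matrix_inv (?A q) *v axis b 1) $ a = det (?B q) / det (?A q)"
      by simp
    then show ?thesis
      by (simp add: matrix_vector_mult_basis column_def)
  qed
qed

lemma chart_diff_lc_coeff:
  assumes p: "p \<in> dom_chart c"
  shows "chart_diff (lc_coeff M c g a b d) p"
proof -
  \<comment> \<open>The explicit argument \<open>q\<close> lets \<open>lc_coeff_def\<close>
    unfold.\<close>
  have "chart_diff (\<lambda>q. lc_coeff M c g a b d q) p"
    unfolding lc_coeff_def
    by (intro chart_diff_mult chart_diff_sum chart_diff_const chart_diff_add chart_diff_diff
        chart_diff_matrix_inv_metric_comp chart_diff_partial_metric_comp p)
  then show ?thesis .
qed

lemma partial_metric_comp_sym:
  assumes p: "p \<in> dom_chart c"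
  shows "partial c k (\<lambda>q. metric_comp M c g q $ a $ b) p =
    partial c k (\<lambda>q. metric_comp M c g q $ b $ a) p"
  by (rule partial_cong[OF M c p]) (rule metric_comp_sym)

lemma lc_coeff_sym:
  "p \<in> dom_chart c \<Longrightarrow> lc_coeff M c g a b d p = lc_coeff M c g a d b p"
  by (simp add: lc_coeff_def partial_metric_comp_sym[of p _ b d] add.commute)

end

section \<open>Relative Christoffel symbols and curvature as differences\<close>

lemma rel_christoffel_eq_diff:
  assumes g: "riemannian_metric M g" and m: "riemannian_metric M m" and p: "p \<in> dom_chart c"
  shows "rel_christoffel M c g m a b d p = lc_coeff M c m a b d p - lc_coeff M c g a b d p"
proof -
  let ?m = "\<lambda>i j q. metric_comp M c m q $ i $ j"
  let ?B = "matrix_inv (metric_comp M c m p)"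
  let ?G = "\<lambda>s. lc_coeff M c g s b d p"
  \<comment> \<open>Of the six connection terms, the two pairs with \<open>n\<close> as a lower
    index of the connection cancel. The remaining two are equal, whence the factor 2.\<close>
  have *: "cov_deriv_02 M c g ?m n b d p + cov_deriv_02 M c g ?m n d b p
         - cov_deriv_02 M c g ?m b d n p =
      (partial c d (?m n b) p + partial c b (?m n d) p - partial c n (?m b d) p)
      - 2 * (\<Sum>s\<in>UNIV. ?m n s p * ?G s)" for n
    unfolding cov_deriv_02_def
    by (simp add: lc_coeff_sym[OF g p, of _ d b] lc_coeff_sym[OF g p, of _ d n]
        lc_coeff_sym[OF g p, of _ b n] metric_comp_sym[OF m p, of b]
        mult.commute)
  \<comment> \<open>Contraction with the inverse of \<open>m\<close> removes \<open>m\<close> from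
    these terms and leaves the connection coefficients of \<open>g\<close>.\<close>
  have "(\<Sum>n\<in>UNIV. ?B $ a $ n * (\<Sum>s\<in>UNIV. ?m n s p * ?G s)) = 
      (?B *v (metric_comp M c m p *v (\<chi> s. ?G s))) $ a"
    by (simp add: matrix_vector_mult_def)
  also have "\<dots> = ?G a"
    by (simp add: matrix_vector_mul_assoc matrix_inv_metric_comp[OF m p])
  finally have "(\<Sum>n\<in>UNIV. ?B $ a $ n * (\<Sum>s\<in>UNIV. ?m n s p * ?G s)) = ?G a" .
  then show ?thesis
    unfolding rel_christoffel_def Let_def *
    by (simp add: lc_coeff_def[of M c m] right_diff_distrib sum_subtractf mult.left_commute[of _ 2]
        flip: sum_distrib_left)
qed

lemma rel_curvature_coord_euclidean_metric:
  assumes p: "p \<in> dom_chart c"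
  shows "rel_curvature M c (coord_euclidean_metric c) g l i j k p =
    partial c j (lc_coeff M c g l i k) p - partial c k (lc_coeff M c g l i j) p
    + (\<Sum>s\<in>UNIV. lc_coeff M c g l j s p * lc_coeff M c g s i k p)
    - (\<Sum>s\<in>UNIV. lc_coeff M c g l k s p * lc_coeff M c g s i j p)"
proof -
  have "partial c d (rel_christoffel M c (coord_euclidean_metric c) g a b e) p =
      partial c d (lc_coeff M c g a b e) p" for a b d e
    by (rule partial_cong[OF M c p]) (rule rel_christoffel_coord_euclidean_metric[OF M c])
  then show ?thesis
    by (simp add: rel_curvature_def cov_deriv_coord_euclidean_metric[OF M c p]
        rel_christoffel_coord_euclidean_metric[OF M c p])
qed

lemma rel_curvature_eq_diff:
  assumes g: "riemannian_metric M g" and m: "riemannian_metric M m" and p: "p \<in> dom_chart c"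
  shows "rel_curvature M c g m l i j k p =
    rel_curvature M c (coord_euclidean_metric c) m l i j k p
    - rel_curvature M c (coord_euclidean_metric c) g l i j k p"
proof -
  let ?G = "\<lambda>a b d. lc_coeff M c g a b d p"
  let ?H = "\<lambda>a b d. lc_coeff M c m a b d p"
  have dT: "partial c d (rel_christoffel M c g m a b e) p =
      partial c d (lc_coeff M c m a b e) p - partial c d (lc_coeff M c g a b e) p" for a b d e
  proof -
    \<comment> \<open>The difference formula holds on the whole chart domain, so it may be
      differentiated. Splitting the derivative then uses differentiability of both sets of
      Christoffel symbols.\<close>
    have "partial c d (rel_christoffel M c g m a b e) p =
        partial c d (\<lambda>q. lc_coeff M c m a b e q - lc_coeff M c g a b e q) p"
      by (rule partial_cong[OF M c p]) (rule rel_christoffel_eq_diff[OF g m])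
    also have "\<dots> = partial c d (lc_coeff M c m a b e) p - partial c d (lc_coeff M c g a b e) p"
      by (intro partial_diff chart_diff_lc_coeff g m p)
    finally show ?thesis .
  qed
  \<comment> \<open>Let \<open>T = H - G\<close>, and read \<open>G\<close>, \<open>H\<close>,
    \<open>T\<close> with a fixed lower index as matrices. The terms with \<open>G s j k\<close>
    cancel by symmetry in \<open>j\<close> and \<open>k\<close>. The other products give
    \<open>[G_j,T_k] + [T_j,G_k] + [T_j,T_k]\<close>, which equals
    \<open>[H_j,H_k] - [G_j,G_k]\<close>.\<close>
  show ?thesis
    unfolding rel_curvature_coord_euclidean_metric[OF p]
    unfolding rel_curvature_def Let_def cov_deriv_12_def dT rel_christoffel_eq_diff[OF g m p]
    by (simp add: lc_coeff_sym[OF g p, of _ k j] lc_coeff_sym[OF g p, of _ j i]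
        lc_coeff_sym[OF g p, of _ k i] lc_coeff_sym[OF g p, of l _ k]
        lc_coeff_sym[OF g p, of l _ j] lc_coeff_sym[OF m p, of l _ k] lc_coeff_sym[OF m p, of l _ j]
        algebra_simps sum_subtractf sum.distrib)
qed

end

theorem theorem4p1:
  fixes M :: "('a, 'n::finite) manifold"
    and g m \<delta> :: "'a metric_field"
    and c :: "('a, 'n) chart"
    and p :: 'a
    and l i j k :: 'n
  assumes "smooth_manifold M"
    and "riemannian_metric M g"
    and "riemannian_metric M m"
    and "c \<in> charts M"
    and "\<delta> = coord_euclidean_metric c"
    and "p \<in> dom_chart c"
  shows "rel_curvature M c \<delta> m l i j k p =
    rel_curvature M c \<delta> g l i j k p + rel_curvature M c g m l i j k p"
  using rel_curvature_eq_diff[of M c g m p l i j k] assms by simp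

end
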